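(* For every $n\in\mathbb{N}$, there is a $\tfrac{3}{2}^+$-free circular word of length $n$ over an alphabet of $4$ letters.
   Context: A word $w=w_1\cdots w_n$ has period $p\ge 1$ if $w_{i+p}=w_i$ for all $1\le i\le n-p$ (so $n$ is always a period). The exponent of a nonempty word is its length divided by its minimal period. Two words $x,y$ are conjugates if $x=uv$ and $y=vu$ for some words $u,v$. For a word $w$, the circular word $(w)$ is the set of all conjugates of $w$; its length is $|w|$. A word is a factor of $(w)$ if it is a (contiguous) factor of some conjugate of $w$. A (linear or circular) word is $\beta^+$-free if it has no factor of exponent strictly greater than $\beta$. *)

theory Defs
  imports Complex_Main "HOL-Library.Sublist"
begin

definition has_period :: "'a list \<Rightarrow> nat \<Rightarrow> bool" where
  "has_period w p \<longleftrightarrow> p \<ge> 1 \<and> (\<forall>i. i + p < length w \<longrightarrow> w ! (i + p) = w ! i)"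

definition min_period :: "'a list \<Rightarrow> nat" where
  "min_period w = (LEAST p. has_period w p)"

(* Only meaningful for nonempty words. *)
definition exponent :: "'a list \<Rightarrow> real" where
  "exponent w = real (length w) / real (min_period w)"

definition conjugates :: "'a list \<Rightarrow> 'a list \<Rightarrow> bool" where
  "conjugates x y \<longleftrightarrow> (\<exists>u v. x = u @ v \<and> y = v @ u)"

definition circular_word :: "'a list \<Rightarrow> 'a list set" where
  "circular_word w = {y. conjugates w y}"

(* Factors are contiguous, which is what sublist (as opposed to subseq) expresses. *)
definition circular_factor :: "'a list \<Rightarrow> 'a list set \<Rightarrow> bool" where
  "circular_factor x C \<longleftrightarrow> (\<exists>y\<in>C. sublist x y)"

(* Being \<beta>^+-free: exponents equal to \<beta> are allowed. *)
definition circular_plus_free :: "real \<Rightarrow> 'a list set \<Rightarrow> bool" where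
  "circular_plus_free \<beta> C \<longleftrightarrow>
     \<not> (\<exists>x. x \<noteq> [] \<and> circular_factor x C \<and> exponent x > \<beta>)"

end

theory Submission
  imports Defs
begin

text \<open>
  Let \<open>phi\<close> be a suitable 9-uniform morphism on four letters. Circular words that are
  \<open>3/2\<^sup>+\<close>-free and contain a fixed seed are lengthened by applying \<open>phi\<close> and inserting a
  word \<open>M\<close> of length \<open>r \<in> {1..9}\<close> into the image of the middle letter of the seed, which turns
  length \<open>m\<close> into length \<open>9 m + r\<close> and reproduces the seed. Factors of length 7 that
  meet \<open>M\<close> occur only once, and the other ones determine their position modulo 9. So a
  repetition of large period avoids \<open>M\<close> in both of its occurrences; discarding \<open>M\<close> from
  between them can only shorten the period, and the repetition then desubstitutes to one in the
  original circular word. Repetitions of small period, and the words of length at most 45, are left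
  to finite checks.
\<close>

section \<open>Repetitions in words and in circular words\<close>

text \<open>
  A word of period \<open>p\<close> has exponent above \<open>3/2\<close> iff its length is at least \<open>p + p div 2 + 1\<close>.
\<close>

definition repeats :: "(nat \<Rightarrow> 'a) \<Rightarrow> nat \<Rightarrow> nat \<Rightarrow> bool" where
  "repeats f p i \<longleftrightarrow> (\<forall>j\<le>p div 2. f (i + j) = f (i + p + j))"

text \<open>Conjugation becomes a shift of the argument of a periodic function. The bound
  \<open>p + p div 2 < n\<close> lets the repetition fit into one conjugate.\<close>

definition circ_free :: "nat \<Rightarrow> (nat \<Rightarrow> 'a) \<Rightarrow> bool" where
  "circ_free n f \<longleftrightarrow>
     (\<forall>i. f (i + n) = f i) \<and> (\<forall>p i. 0 < p \<longrightarrow> p + p div 2 < n \<longrightarrow> \<not> repeats f p i)"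

lemma circ_free_mod:
  assumes "circ_free n f"
  shows "f (i mod n) = f i"
proof -
  have "f (i + k * n) = f i" for i k
    using assms by (induction k) (simp_all add: circ_free_def add.assoc[symmetric] add.commute[of n])
  from this[of "i mod n" "i div n"] show ?thesis by simp
qed

lemma circ_free_cong_mod:
  assumes "circ_free n f" and "i mod n = j mod n"
  shows "f i = f j"
  using circ_free_mod[OF assms(1)] assms(2) by metis

lemma circ_free_shift:
  assumes "circ_free n f"
  shows "circ_free n (\<lambda>i. f (i + s))"
proof -
  have "repeats (\<lambda>i. f (i + s)) p i \<longleftrightarrow> repeats f p (i + s)" for p i
    by (simp add: repeats_def add_ac)
  moreover have "f (i + n + s) = f (i + s)" for i
    using circ_free_cong_mod[OF assms] by (metis add.assoc add.commute mod_add_self2)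
  ultimately show ?thesis using assms by (simp add: circ_free_def)
qed

text \<open>A factor with minimal period \<open>p\<close> and exponent above 3/2 has more than
  \<open>p + p div 2\<close> letters, so its prefix of length \<open>p + p div 2 + 1\<close> is an
  instance of \<open>repeats\<close>.\<close>

lemma circ_free_imp_circular_plus_free:
  assumes f: "circ_free n f" and e: "inj e"
  shows "circular_plus_free (3/2) (circular_word (map (\<lambda>i. e (f i)) [0..<n]))"
proof -
  let ?w = "map (\<lambda>i. e (f i)) [0..<n]"
  have False if x: "x \<noteq> []" "circular_factor x (circular_word ?w)" "exponent x > 3/2" for x
  proof -
    from x(2) obtain u v where uv: "?w = u @ v" and "sublist x (v @ u)"
      by (auto simp: circular_factor_def circular_word_def conjugates_def)
    then obtain a b where ab: "v @ u = a @ x @ b" by (auto simp: sublist_def)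
    have len: "length a + length x + length b = n"
      using arg_cong[OF ab, of length] arg_cong[OF uv, of length] by simp
    have n: "n > 0" using len x(1) by (cases x) auto
    have rot: "v @ u = rotate (length u) ?w" by (simp add: uv rotate_append)
    have nth: "x ! j = e (f (length u + length a + j))" if "j < length x" for j
    proof -
      have "x ! j = (v @ u) ! (length a + j)" using that by (simp add: ab nth_append)
      also have "\<dots> = ?w ! ((length u + (length a + j)) mod n)"
        unfolding rot using that len by (subst nth_rotate) simp_all
      also have "\<dots> = e (f (length u + length a + j))"
        using n circ_free_mod[OF f] by (simp add: add.assoc)
      finally show ?thesis .
    qed
    define p where "p = min_period x"
    have "has_period x (length x)" using x(1) by (cases x) (auto simp: has_period_def)
    then have p: "has_period x p" unfolding p_def min_period_def by (rule LeastI)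
    then have p0: "0 < p" by (simp add: has_period_def)
    have "real (length x) / real p > 3/2" using x(3) by (simp add: exponent_def p_def)
    then have "2 * real (length x) > 3 * real p" using p0 by (simp add: field_simps)
    then have "2 * length x > 3 * p" by linarith
    then have lx: "p + p div 2 < length x" by linarith
    have "repeats f p (length u + length a)"
      unfolding repeats_def
    proof (intro allI impI)
      fix j assume j: "j \<le> p div 2"
      then have "j + p < length x" using lx by simp
      then have "x ! (j + p) = x ! j" using p by (simp add: has_period_def)
      then show "f (length u + length a + j) = f (length u + length a + p + j)"
        using nth[of j] nth[of "j + p"] \<open>j + p < length x\<close> e by (simp add: inj_eq add_ac)
    qed
    moreover have "p + p div 2 < n" using lx len by simp
    ultimately show False using f p0 by (simp add: circ_free_def)
  qed
  then show ?thesis by (auto simp: circular_plus_free_def)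
qed

section \<open>Executable search for repetitions in lists\<close>

fun agree :: "nat \<Rightarrow> 'a list \<Rightarrow> 'a list \<Rightarrow> bool" where
  "agree 0 us vs = True"
| "agree (Suc k) (u # us) (v # vs) = (u = v \<and> agree k us vs)"
| "agree (Suc k) us vs = False"

fun no_agreement :: "nat \<Rightarrow> 'a list \<Rightarrow> 'a list \<Rightarrow> bool" where
  "no_agreement k (u # us) (v # vs) = (\<not> agree k (u # us) (v # vs) \<and> no_agreement k us vs)"
| "no_agreement k us vs = True"

definition free_upto :: "nat \<Rightarrow> 'a list \<Rightarrow> bool" where
  "free_upto b ws \<longleftrightarrow> (\<forall>p\<in>set [1..<Suc b]. no_agreement (Suc (p div 2)) ws (drop p ws))"

lemma agree_iff:
  "agree k us vs \<longleftrightarrow> k \<le> length us \<and> k \<le> length vs \<and> (\<forall>j<k. us ! j = vs ! j)"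
  by (induction k us vs rule: agree.induct) (auto simp: less_Suc_eq_0_disj)

lemma no_agreementD:
  assumes "no_agreement k us vs" and "0 < k" and "i + k \<le> length us" and "i + k \<le> length vs"
  shows "\<exists>j<k. us ! (i + j) \<noteq> vs ! (i + j)"
  using assms
proof (induction k us vs arbitrary: i rule: no_agreement.induct)
  case (1 k u us v vs)
  then show ?case by (cases i) (auto simp: agree_iff)
qed auto

lemma free_uptoD:
  assumes "free_upto b ws" and "0 < p" and "p \<le> b" and "i + p + p div 2 < length ws"
  shows "\<exists>j\<le>p div 2. ws ! (i + j) \<noteq> ws ! (i + p + j)"
proof -
  have "no_agreement (Suc (p div 2)) ws (drop p ws)" using assms by (auto simp: free_upto_def)
  from no_agreementD[OF this, of i] assms(4) show ?thesis by (auto simp: less_Suc_eq_le add_ac)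
qed

text \<open>Every factor of the circular word starts in the first half of \<open>ws @ ws\<close>.
  The bound on the periods comes from \<open>p + p div 2 < n\<close> being equivalent to
  \<open>3 * p < 2 * n\<close>.\<close>

lemma circ_free_nth_mod:
  assumes free: "free_upto ((2 * length ws - 1) div 3) (ws @ ws)" and n: "ws \<noteq> []"
  shows "circ_free (length ws) (\<lambda>i. ws ! (i mod length ws))"
proof -
  have "\<not> repeats (\<lambda>i. ws ! (i mod length ws)) p i" if p: "0 < p" "p + p div 2 < length ws" for p i
  proof
    assume rep: "repeats (\<lambda>i. ws ! (i mod length ws)) p i"
    have nth: "(ws @ ws) ! j = ws ! (j mod length ws)" if "j < 2 * length ws" for j
      using that by (cases "j < length ws") (simp_all add: nth_append le_mod_geq)
    define k where "k = i mod length ws"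
    have k: "k < length ws" using n by (simp add: k_def)
    have b: "p \<le> (2 * length ws - 1) div 3" using p by linarith
    have "k + p + p div 2 < length (ws @ ws)" using k p by simp
    from free_uptoD[OF free p(1) b this] obtain j
      where j: "j \<le> p div 2" "(ws @ ws) ! (k + j) \<noteq> (ws @ ws) ! (k + p + j)"
      by blast
    have "ws ! ((k + j) mod length ws) \<noteq> ws ! ((k + p + j) mod length ws)"
      using j(2) nth[of "k + j"] nth[of "k + p + j"] k p j(1) by simp
    moreover have "(k + l) mod length ws = (i + l) mod length ws" for l
      unfolding k_def by (rule mod_add_left_eq)
    then have "ws ! ((k + j) mod length ws) = ws ! ((k + p + j) mod length ws)"
      using rep j(1) by (simp add: repeats_def add.assoc)
    ultimately show False by simp
  qed
  then show ?thesis by (simp add: circ_free_def)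
qed

section \<open>The morphism and the finite checks\<close>

datatype letter = W | X | Y | Z

text \<open>The images arise from \<open>phi W\<close> by the double transpositions of the letters,
  a Klein four-group acting regularly. So at each of the nine places the four images have four
  different letters.\<close>

primrec phi :: "letter \<Rightarrow> letter list" where
  "phi W = [W,X,Y,X,W,Z,X,Y,W]"
| "phi X = [X,W,Z,W,X,Y,W,Z,X]"
| "phi Y = [Y,Z,W,Z,Y,X,Z,W,Y]"
| "phi Z = [Z,Y,X,Y,Z,W,Y,X,Z]"

definition letters :: "letter list" where
  "letters = [W, X, Y, Z]"

definition seed :: "letter list" where
  "seed = [W,X,Y,W,Z]"

definition seed_image :: "letter list" where
  "seed_image = concat (map phi seed)"

definition insertions :: "letter list list" where
  "insertions =
    [[W],
     [Y,W],
     [W,X,Y],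
     [W,X,Y,W],
     [W,X,Z,X,W],
     [W,X,Y,W,Z,Y],
     [W,X,Y,W,Y,X,W],
     [W,X,Y,W,Y,Z,X,W],
     [W,X,Y,W,Y,X,W,Z,Y]]"

text \<open>Place 24 is in the third block, after the sixth letter of \<open>phi Y\<close>.\<close>

definition extended_seed :: "letter list \<Rightarrow> letter list" where
  "extended_seed M = take 24 seed_image @ M @ drop 24 seed_image"

text \<open>Two blocks suffice for offsets \<open>s < 9\<close>, and only distinct ones are needed
  because neighbouring letters of a free word differ.\<close>

definition block_windows :: "nat \<Rightarrow> letter list list" where
  "block_windows s = [take 7 (drop s (phi x @ phi y)). x \<leftarrow> letters, y \<leftarrow> letters, x \<noteq> y]"

text \<open>\<open>M\<close> occupies the places 24 to \<open>23 + length M\<close>, so these are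
  exactly the windows that meet it.\<close>

definition seed_windows :: "letter list \<Rightarrow> letter list list" where
  "seed_windows M = map (\<lambda>i. take 7 (drop i (extended_seed M))) [18..<24 + length M]"

text \<open>From 46 = 9 * 5 + 1 on, every length is reached from a shorter one that is at least
  5.\<close>

definition base_words :: "letter list list" where
  "base_words =
    [[W,X,Y,W,Z],
     [W,X,Y,W,Z,X],
     [W,X,Y,W,Z,X,Z],
     [W,X,Y,W,Z,W,Y,X],
     [W,X,Y,W,Z,W,X,Z,X],
     [W,X,Y,W,Z,W,X,Z,Y,X],
     [W,X,Y,W,Z,W,X,W,Y,Z,X],
     [W,X,Y,W,Z,W,X,W,Y,W,Z,X],
     [W,X,Y,W,Z,W,X,W,Y,W,X,Z,X],
     [W,X,Y,W,Z,W,X,W,Y,W,X,Z,Y,X],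
     [W,X,Y,W,Z,W,X,W,Y,W,X,Y,X,Z,X],
     [W,X,Y,W,Z,W,X,W,Y,W,X,Y,Z,W,Y,X],
     [W,X,Y,W,Z,W,X,W,Y,W,X,Y,X,W,Y,Z,X],
     [W,X,Y,W,Z,W,X,W,Y,W,X,Y,X,W,Z,Y,Z,X],
     [W,X,Y,W,Z,W,X,W,Y,W,X,Y,X,W,X,Z,W,Z,X],
     [W,X,Y,W,Z,W,X,W,Y,W,X,Y,X,W,X,Z,W,Y,Z,X],
     [W,X,Y,W,Z,W,X,W,Y,W,X,Y,X,W,X,Z,W,Y,W,Z,X],
     [W,X,Y,W,Z,W,X,W,Y,W,X,Y,X,W,X,Z,W,Y,W,Z,Y,X],
     [W,X,Y,W,Z,W,X,W,Y,W,X,Y,X,W,X,Z,W,Y,W,Z,X,Y,X],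
     [W,X,Y,W,Z,W,X,W,Y,W,X,Y,X,W,X,Z,W,Y,W,X,W,Y,Z,X],
     [W,X,Y,W,Z,W,X,W,Y,W,X,Y,X,W,X,Z,W,Y,W,X,W,Y,X,Z,X],
     [W,X,Y,W,Z,W,X,W,Y,W,X,Y,X,W,X,Z,W,Y,W,X,W,Y,X,Y,Z,X],
     [W,X,Y,W,Z,W,X,W,Y,W,X,Y,X,W,X,Z,W,Y,W,X,W,Y,X,Y,Z,Y,X],
     [W,X,Y,W,Z,W,X,W,Y,W,X,Y,X,W,X,Z,W,Y,W,X,W,Y,X,Y,W,X,Z,X],
     [W,X,Y,W,Z,W,X,W,Y,W,X,Y,X,W,X,Z,W,Y,W,X,W,Y,X,Y,W,X,Z,Y,X],
     [W,X,Y,W,Z,W,X,W,Y,W,X,Y,X,W,X,Z,W,Y,W,X,W,Y,X,Y,W,X,Z,W,Y,X],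
     [W,X,Y,W,Z,W,X,W,Y,W,X,Y,X,W,X,Z,W,Y,W,X,W,Y,X,Y,W,X,Z,W,Y,Z,X],
     [W,X,Y,W,Z,W,X,W,Y,W,X,Y,X,W,X,Z,W,Y,W,X,W,Y,X,Y,W,X,Z,W,Y,X,Z,X],
     [W,X,Y,W,Z,W,X,W,Y,W,X,Y,X,W,X,Z,W,Y,W,X,W,Y,X,Y,W,X,Z,W,Y,Z,X,Y,X],
     [W,X,Y,W,Z,W,X,W,Y,W,X,Y,X,W,X,Z,W,Y,W,X,W,Y,X,Y,W,X,Z,W,Y,X,Z,X,Y,X],
     [W,X,Y,W,Z,W,X,W,Y,W,X,Y,X,W,X,Z,W,Y,W,X,W,Y,X,Y,W,X,Z,W,Y,X,W,Z,Y,Z,X],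
     [W,X,Y,W,Z,W,X,W,Y,W,X,Y,X,W,X,Z,W,Y,W,X,W,Y,X,Y,W,X,Z,W,Y,X,W,X,Z,Y,Z,X],
     [W,X,Y,W,Z,W,X,W,Y,W,X,Y,X,W,X,Z,W,Y,W,X,W,Y,X,Y,W,X,Z,W,Y,X,W,X,Z,Y,W,Z,X],
     [W,X,Y,W,Z,W,X,W,Y,W,X,Y,X,W,X,Z,W,Y,W,X,W,Y,X,Y,W,X,Z,W,Y,X,W,X,Y,X,Z,W,Z,X],
     [W,X,Y,W,Z,W,X,W,Y,W,X,Y,X,W,X,Z,W,Y,W,X,W,Y,X,Y,W,X,Z,W,Y,X,W,X,Y,X,Z,W,Y,Z,X],
     [W,X,Y,W,Z,W,X,W,Y,W,X,Y,X,W,X,Z,W,Y,W,X,W,Y,X,Y,W,X,Z,W,Y,X,W,X,Y,W,Y,X,Z,W,Z,X],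
     [W,X,Y,W,Z,W,X,W,Y,W,X,Y,X,W,X,Z,W,Y,W,X,W,Y,X,Y,W,X,Z,W,Y,X,W,X,Y,W,Y,X,Y,Z,W,Z,X],
     [W,X,Y,W,Z,W,X,W,Y,W,X,Y,X,W,X,Z,W,Y,W,X,W,Y,X,Y,W,X,Z,W,Y,X,W,X,Y,W,Y,X,Y,Z,W,X,Z,X],
     [W,X,Y,W,Z,W,X,W,Y,W,X,Y,X,W,X,Z,W,Y,W,X,W,Y,X,Y,W,X,Z,W,Y,X,W,X,Y,W,Y,X,Y,Z,W,X,Z,Y,X],
     [W,X,Y,W,Z,W,X,W,Y,W,X,Y,X,W,X,Z,W,Y,W,X,W,Y,X,Y,W,X,Z,W,Y,X,W,X,Y,W,Y,X,Y,Z,W,X,W,Y,Z,X],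
     [W,X,Y,W,Z,W,X,W,Y,W,X,Y,X,W,X,Z,W,Y,W,X,W,Y,X,Y,W,X,Z,W,Y,X,W,X,Y,W,Y,X,Y,Z,W,X,W,Y,W,Z,X]]"

section \<open>Finite checks by evaluation\<close>

lemma length_seed: "length seed = 5"
  by (simp add: seed_def)

lemma set_letters: "set letters = UNIV"
proof -
  have "x \<in> set letters" for x by (cases x) (simp_all add: letters_def)
  then show ?thesis by blast
qed

lemma length_phi: "length (phi x) = 9"
  by (cases x) simp_all

lemma phi_nth_inj:
  assumes "phi x ! s = phi y ! s" and "s < 9"
  shows "x = y"
proof -
  have "\<forall>x\<in>set letters. \<forall>y\<in>set letters. x = y \<or> (\<forall>s\<in>set [0..<9]. phi x ! s \<noteq> phi y ! s)"
    by code_simp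
  with assms show ?thesis unfolding set_letters by fastforce
qed

text \<open>A repetition of period at most 11 has at most 17 letters. From period 12 on, the
  repeated part of \<open>p div 2 + 1\<close> letters contains a window of length 7.\<close>

lemma phi_free:
  assumes "x \<noteq> y" and "y \<noteq> z"
  shows "free_upto 11 (concat (map phi [x, y, z]))"
proof -
  have "\<forall>x\<in>set letters. \<forall>y\<in>set letters. \<forall>z\<in>set letters.
    x = y \<or> y = z \<or> free_upto 11 (concat (map phi [x, y, z]))"
    by code_simp
  with assms show ?thesis unfolding set_letters by blast
qed

lemma extended_seed_free:
  assumes "M \<in> set insertions"
  shows "free_upto 11 (extended_seed M)"
proof -
  have "\<forall>M\<in>set insertions. free_upto 11 (extended_seed M)"
    by code_simp
  with assms show ?thesis by blast
qed

text \<open>Synchronisation, which later forces periods to be multiples of 9.\<close>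

lemma block_windows_disjoint:
  assumes "ws \<in> set (block_windows s)" and "ws \<in> set (block_windows t)" and "s < 9" and "t < 9"
  shows "s = t"
proof -
  have "\<forall>s\<in>set [0..<9]. \<forall>t\<in>set [0..<s].
    \<forall>ws\<in>set (block_windows s). ws \<notin> set (block_windows t)"
    by code_simp
  then have "\<forall>ws\<in>set (block_windows s). ws \<notin> set (block_windows t)" if "t < s" "s < 9" for s t
    using that by simp
  with assms show ?thesis by (meson linorder_neqE_nat)
qed

lemma distinct_seed_windows:
  assumes "M \<in> set insertions"
  shows "distinct (seed_windows M)"
proof -
  have "\<forall>M\<in>set insertions. distinct (seed_windows M)"
    by code_simp
  with assms show ?thesis by blast
qed

text \<open>With \<open>distinct_seed_windows\<close>, this makes a window that meets the insertion
  occur only once.\<close>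

lemma seed_windows_block_windows_disjoint:
  assumes "M \<in> set insertions" and "ws \<in> set (seed_windows M)" and "s < 9"
  shows "ws \<notin> set (block_windows s)"
proof -
  have "\<forall>M\<in>set insertions. \<forall>s\<in>set [0..<9].
    \<forall>ws\<in>set (block_windows s). ws \<notin> set (seed_windows M)"
    by code_simp
  with assms show ?thesis by auto
qed

lemma ex_insertion:
  assumes "1 \<le> r" and "r \<le> 9"
  shows "\<exists>M\<in>set insertions. length M = r"
proof -
  have len: "map length insertions = [1..<10]"
    by code_simp
  have "r \<in> set (map length insertions)" unfolding len set_upt using assms by simp
  then show ?thesis by auto
qed

lemma ex_base_word:
  assumes "5 \<le> n" and "n < 46"
  shows "\<exists>f. circ_free n f \<and> (\<forall>i<5. f i = seed ! i)"
proof -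
  have len: "map length base_words = [5..<46]"
    by code_simp
  have "n \<in> set (map length base_words)" unfolding len set_upt using assms by simp
  then obtain ws where ws: "ws \<in> set base_words" "length ws = n" by auto
  have "\<forall>ws\<in>set base_words. take 5 ws = seed \<and> free_upto ((2 * length ws - 1) div 3) (ws @ ws)"
    by code_simp
  with ws have "take 5 ws = seed" and free: "free_upto ((2 * length ws - 1) div 3) (ws @ ws)"
    by auto
  then have "\<forall>i<5. ws ! (i mod n) = seed ! i" using assms ws(2) by (metis mod_less nth_take order_less_le_trans)
  moreover have "circ_free n (\<lambda>i. ws ! (i mod n))"
    using circ_free_nth_mod[OF free] ws(2) assms(1) by (cases ws) auto
  ultimately show ?thesis by blast
qed

section \<open>Lengthening a circular word\<close>

definition morph :: "(nat \<Rightarrow> letter) \<Rightarrow> nat \<Rightarrow> letter" where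
  "morph f i = phi (f (i div 9)) ! (i mod 9)"

lemma nth_concat_phi:
  "i < 9 * length xs \<Longrightarrow> concat (map phi xs) ! i = phi (xs ! (i div 9)) ! (i mod 9)"
proof (induction xs arbitrary: i)
  case (Cons x xs)
  show ?case
  proof (cases "i < 9")
    case False
    then have "i div 9 = Suc ((i - 9) div 9)" "(i - 9) mod 9 = i mod 9"
      by (simp_all add: le_div_geq le_mod_geq)
    with False Cons.IH[of "i - 9"] Cons.prems show ?thesis
      by (simp add: nth_append length_phi)
  qed (simp add: nth_append length_phi)
qed simp

lemma length_concat_phi: "length (concat (map phi xs)) = 9 * length xs"
  by (induction xs) (simp_all add: length_phi)

definition window :: "(nat \<Rightarrow> 'a) \<Rightarrow> nat \<Rightarrow> 'a list" where
  "window f i = map (\<lambda>j. f (i + j)) [0..<7]"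

lemma window_eqI: "(\<And>j. j < 7 \<Longrightarrow> f (i + j) = g (k + j)) \<Longrightarrow> window f i = window g k"
  by (simp add: window_def)

lemma window_eq_take_drop:
  assumes "\<And>j. j < 7 \<Longrightarrow> f (i + j) = ws ! (k + j)" and "k + 7 \<le> length ws"
  shows "window f i = take 7 (drop k ws)"
  using assms by (intro nth_equalityI) (simp_all add: window_def)

lemma repeats_window:
  assumes "repeats f p i" and "j + 6 \<le> p div 2"
  shows "window f (i + j) = window f (i + p + j)"
  using assms by (intro window_eqI) (simp add: repeats_def add.assoc)

locale lengthening =
  fixes f :: "nat \<Rightarrow> letter" and m :: nat and M :: "letter list"
  assumes f: "circ_free m f" and m: "5 \<le> m" and f_seed: "\<And>i. i < 5 \<Longrightarrow> f i = seed ! i"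
    and M: "M \<in> set insertions"
begin

abbreviation "r \<equiv> length M"
abbreviation "n \<equiv> 9 * m + r"

text \<open>
  The new word read from the insertion on: position 0 is the first letter of \<open>M\<close>, and
  position \<open>r\<close> is position 24 of the image of \<open>f\<close>.
\<close>

definition g :: "nat \<Rightarrow> letter" where
  "g i = (let k = i mod n in if k < r then M ! k else morph f (k - r + 24))"

lemma r_le: "r \<le> 9"
proof -
  have "\<forall>M\<in>set insertions. length M \<le> 9" by (simp add: insertions_def)
  with M show ?thesis by blast
qed

lemma f_neq: "f i \<noteq> f (Suc i)"
  using f m by (auto simp: circ_free_def repeats_def dest: spec[of _ 1])

lemma morph_periodic: "morph f (i + 9 * m) = morph f i"
  using f by (simp add: morph_def circ_free_def add.commute[of m])

lemma g_periodic: "g (i + n) = g i"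
  by (simp add: g_def)

lemma g_add_period: "k = l \<or> k = l + n \<Longrightarrow> g (k + j) = g (l + j)"
  using g_periodic[of "l + j"] by (auto simp: add_ac)

lemma g_cong_mod: "i mod n = j mod n \<Longrightarrow> g i = g j"
  by (simp add: g_def)

lemma g_eq_morph: "r \<le> i \<Longrightarrow> i < n \<Longrightarrow> g i = morph f (i - r + 24)"
  by (simp add: g_def)

lemma morph_eq_seed_image: "i < 45 \<Longrightarrow> morph f i = seed_image ! i"
  by (simp add: morph_def seed_image_def nth_concat_phi f_seed length_seed)

lemma length_seed_image: "length seed_image = 45"
  by (simp add: seed_image_def length_concat_phi length_seed)

lemma length_extended_seed: "length (extended_seed M) = 45 + r"
  by (simp add: extended_seed_def length_seed_image)

text \<open>The next copy of \<open>M\<close> starts at \<open>n\<close>. By periodicity of the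
  image, the first 24 letters of \<open>seed_image\<close> precede it, and the remaining ones follow
  it.\<close>

lemma g_eq_extended_seed:
  assumes "n \<le> i + 24" and "i < n + r + 21"
  shows "g i = extended_seed M ! (i + 24 - n)"
proof -
  consider "i < n" | "n \<le> i" "i < n + r" | "n + r \<le> i" by linarith
  then show ?thesis
  proof cases
    case 1
    then have "g i = morph f (i - r + 24)" using assms m by (intro g_eq_morph) auto
    also have "i - r + 24 = (i + 24 - n) + 9 * m" using assms m by auto
    also have "morph f \<dots> = seed_image ! (i + 24 - n)"
      unfolding morph_periodic using 1 by (intro morph_eq_seed_image) auto
    finally show ?thesis
      using 1 assms by (simp add: extended_seed_def nth_append length_seed_image less_diff_conv2)
  next
    case 2
    then have "i mod n = i - n" using m r_le by (simp add: mod_if)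
    then have "g i = M ! (i - n)" using 2 by (simp add: g_def less_diff_conv2)
    then show ?thesis using 2 by (auto simp: extended_seed_def nth_append length_seed_image)
  next
    case 3
    then have "i mod n = i - n" using m r_le assms by (simp add: mod_if)
    moreover have "\<not> i - n < r" using 3 by linarith
    ultimately have "g i = morph f (i - n - r + 24)" by (simp add: g_def)
    also have "\<dots> = seed_image ! (i - n - r + 24)"
      using assms 3 by (intro morph_eq_seed_image) auto
    finally show ?thesis using 3 assms
      by (auto simp: extended_seed_def nth_append length_seed_image add.commute)
  qed
qed

section \<open>Periods at most 11\<close>

lemma morph_no_short_repeats:
  assumes p: "0 < p" "p \<le> 11"
  shows "\<not> repeats (morph f) p i"
proof
  assume rep: "repeats (morph f) p i"
  \<comment> \<open>With offset at most 8 and at most 17 letters, the repetition stays within these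
    three blocks.\<close>
  let ?xs = "[f (i div 9), f (Suc (i div 9)), f (Suc (Suc (i div 9)))]"
  have nth: "morph f (i + j) = concat (map phi ?xs) ! (i mod 9 + j)" if "j < 18" for j
  proof -
    define k where "k = i mod 9 + j"
    have k: "k < 27" using that unfolding k_def by (simp add: less_eq_Suc_le)
    have ij: "i + j = 9 * (i div 9) + k" by (simp add: k_def)
    have "morph f (i + j) = phi (f (i div 9 + k div 9)) ! (k mod 9)"
      unfolding ij morph_def by simp
    moreover have "k div 9 < 3" using k by linarith
    then have "?xs ! (k div 9) = f (i div 9 + k div 9)"
      by (auto simp: less_Suc_eq numeral_3_eq_3)
    ultimately show ?thesis using k nth_concat_phi[of k ?xs] by (simp add: k_def)
  qed
  have "i mod 9 < 9" by simp
  then have "i mod 9 + p + p div 2 < length (concat (map phi ?xs))"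
    unfolding length_concat_phi using p by simp
  from free_uptoD[OF phi_free[OF f_neq f_neq] p this] obtain j where
    j: "j \<le> p div 2"
      "concat (map phi ?xs) ! (i mod 9 + j) \<noteq> concat (map phi ?xs) ! (i mod 9 + (p + j))"
    by (auto simp: add.assoc)
  have "morph f (i + j) \<noteq> morph f (i + (p + j))"
    using j p nth[of j] nth[of "p + j"] by simp
  with rep j(1) show False by (simp add: repeats_def add.assoc)
qed

lemma g_no_short_repeats:
  assumes p: "0 < p" "p \<le> 11" and i: "r \<le> i" "i < n + r"
  shows "\<not> repeats g p i"
proof
  assume rep: "repeats g p i"
  show False
  \<comment> \<open>A repetition ending before \<open>n\<close> lies in the image of
    \<open>f\<close>. Any other starts at \<open>n - 16\<close> or later and lies in the copy of
    \<open>extended_seed M\<close> around \<open>n\<close>.\<close>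
  proof (cases "i + p + p div 2 < n")
    case True
    have "repeats (morph f) p (i - r + 24)"
      unfolding repeats_def
    proof (intro allI impI)
      fix j assume j: "j \<le> p div 2"
      then have "g (i + j) = g (i + p + j)" using rep by (simp add: repeats_def)
      then show "morph f (i - r + 24 + j) = morph f (i - r + 24 + p + j)"
        using g_eq_morph[of "i + j"] g_eq_morph[of "i + p + j"] True j i(1) by (simp add: add_ac)
    qed
    then show False using morph_no_short_repeats p by blast
  next
    case False
    have "i + 24 - n + p + p div 2 < length (extended_seed M)"
      unfolding length_extended_seed using p i by linarith
    from free_uptoD[OF extended_seed_free[OF M] p this] obtain j where
      j: "j \<le> p div 2" "extended_seed M ! (i + 24 - n + j) \<noteq> extended_seed M ! (i + 24 - n + p + j)"
      by blast
    have "g (i + j) \<noteq> g (i + p + j)"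
      using j p i False g_eq_extended_seed[of "i + j"] g_eq_extended_seed[of "i + p + j"]
      by (simp add: add_ac)
    with rep j(1) show False by (simp add: repeats_def)
  qed
qed

section \<open>Windows of length 7\<close>

lemma window_morph: "window (morph f) i \<in> set (block_windows (i mod 9))"
proof -
  let ?B = "phi (f (i div 9)) @ phi (f (Suc (i div 9)))"
  have "window (morph f) i = take 7 (drop (i mod 9) ?B)"
  proof (rule window_eq_take_drop)
    fix j :: nat assume "j < 7"
    define k where "k = i mod 9 + j"
    have k: "k < 18" using \<open>j < 7\<close> unfolding k_def by (simp add: less_eq_Suc_le)
    have "i + j = 9 * (i div 9) + k" by (simp add: k_def)
    then have "morph f (i + j) = phi (f (i div 9 + k div 9)) ! (k mod 9)"
      unfolding morph_def by simp
    also have "\<dots> = ?B ! k" using k by (auto simp: nth_append length_phi le_div_geq le_mod_geq)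
    finally show "morph f (i + j) = ?B ! (i mod 9 + j)" by (simp add: k_def)
  next
    have "i mod 9 < 9" by simp
    then show "i mod 9 + 7 \<le> length ?B" unfolding length_append length_phi by linarith
  qed
  moreover have "take 7 (drop s (phi x @ phi y)) \<in> set (block_windows s)" if "x \<noteq> y" for x y s
    using that by (auto simp: block_windows_def set_letters)
  ultimately show ?thesis using f_neq by metis
qed

lemma window_g_inner:
  assumes "r \<le> i" and "i + 7 \<le> n"
  shows "window g i = window (morph f) (i - r + 24)"
  using assms by (intro window_eqI) (simp add: g_eq_morph add_ac)

text \<open>Place \<open>i\<close> is place \<open>i + 24 - n\<close> of
  \<open>extended_seed M\<close>, and \<open>seed_windows\<close> starts at place 18; hence the
  index \<open>i + 6 - n\<close>.\<close>

lemma window_g_outer: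
  assumes "n < i + 7" and "i < n + r"
  shows "window g i = seed_windows M ! (i + 6 - n)" and "i + 6 - n < length (seed_windows M)"
proof -
  have "window g i = take 7 (drop (i + 24 - n) (extended_seed M))"
    using assms by (intro window_eq_take_drop) (simp_all add: g_eq_extended_seed length_extended_seed add_ac)
  then show "window g i = seed_windows M ! (i + 6 - n)" "i + 6 - n < length (seed_windows M)"
    using assms by (auto simp: seed_windows_def add_ac)
qed

text \<open>A window that meets the insertion does not recur, so both are windows of the image and
  synchronisation applies.\<close>

lemma window_g_eqD:
  assumes eq: "window g i = window g j" and "i \<noteq> j"
    and i: "r \<le> i" "i < n + r" and j: "r \<le> j" "j < n + r"
  shows "i + 7 \<le> n \<and> j + 7 \<le> n \<and> (i - r + 24) mod 9 = (j - r + 24) mod 9"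
proof -
  have inner: "\<exists>s<9. window g k \<in> set (block_windows s) \<and> s = (k - r + 24) mod 9"
    if "k + 7 \<le> n" "r \<le> k" for k
    using window_g_inner[of k] window_morph that by simp
  have outer: "window g k \<in> set (seed_windows M)" if "n < k + 7" "k < n + r" for k
    using window_g_outer[OF that] by simp
  have mixed: False if "k + 7 \<le> n" "r \<le> k" "n < l + 7" "l < n + r" "window g k = window g l" for k l
    using inner[of k] outer[of l] seed_windows_block_windows_disjoint[OF M] that by metis
  consider "i + 7 \<le> n" "j + 7 \<le> n" | "i + 7 \<le> n" "n < j + 7" | "n < i + 7" "j + 7 \<le> n"
    | "n < i + 7" "n < j + 7" by linarith
  then show ?thesis
  proof cases
    case 1
    then show ?thesis using inner[of i] inner[of j] eq i j block_windows_disjoint by metis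
  next
    case 4
    then have "i + 6 - n = j + 6 - n"
      using window_g_outer[of i] window_g_outer[of j] eq i j distinct_seed_windows[OF M]
      by (simp add: nth_eq_iff_index_eq)
    then show ?thesis using 4 \<open>i \<noteq> j\<close> by linarith
  qed (use mixed eq i j in metis)+
qed

section \<open>Desubstitution and periods at least 12\<close>

lemma morph_repeats_imp_repeats:
  assumes eq: "\<And>j. j < q \<Longrightarrow> morph f (i + j) = morph f (i + 9 * p + j)"
    and q: "9 * p < 2 * q"
  shows "repeats f p (i div 9)"
  unfolding repeats_def
proof (intro allI impI)
  fix j assume j: "j \<le> p div 2"
  \<comment> \<open>The first place of block \<open>i div 9 + j\<close> that is not before
    \<open>i\<close>. It is among the \<open>q\<close> compared places since
    \<open>18 * j \<le> 9 * p < 2 * q\<close>, and one common letter at equal offsets identifies the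
    preimages.\<close>
  define k where "k = max i (9 * (i div 9 + j))"
  have ik: "i \<le> k" "9 * (i div 9 + j) \<le> k" by (simp_all add: k_def)
  have "9 * (i div 9) \<le> i" by simp
  moreover have "2 * j \<le> p" using j by linarith
  ultimately have kq: "k < i + q" using q by (simp add: k_def distrib_left)
  have "i < 9 * (i div 9) + 9" by linarith
  then have "k < 9 * (i div 9 + j) + 9" by (simp add: k_def)
  with ik have kdiv: "k div 9 = i div 9 + j" by (intro div_nat_eqI) simp_all
  have "k - i < q" using ik kq by linarith
  then have "morph f k = morph f (k + 9 * p)" using eq[of "k - i"] ik by (simp add: add_ac)
  then have "phi (f (i div 9 + j)) ! (k mod 9) = phi (f (i div 9 + j + p)) ! (k mod 9)"
    unfolding morph_def using kdiv by (simp add: add_ac)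
  then show "f (i div 9 + j) = f (i div 9 + p + j)"
    using phi_nth_inj[of _ "k mod 9"] by (simp add: add_ac)
qed

lemma g_no_long_repeats:
  assumes p: "12 \<le> p" "p + p div 2 < n" and i: "r \<le> i" "i < n + r"
  shows "\<not> repeats g p i"
proof
  assume rep: "repeats g p i"
  \<comment> \<open>The start of the second occurrence, reduced modulo \<open>n\<close> to the range
    from \<open>r\<close> to \<open>n + r - 1\<close>.\<close>
  define i' where "i' = (if i + p < n + r then i + p else i + p - n)"
  have i': "r \<le> i'" "i' < n + r" "i \<noteq> i'" using p i by (auto simp: i'_def)
  have g': "g (i + p + j) = g (i' + j)" for j
    by (rule g_add_period) (auto simp: i'_def)
  have win: "window g (i + j) = window g (i' + j)" if "j + 6 \<le> p div 2" for j
    using repeats_window[OF rep that] g' by (simp add: window_def add.assoc)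
  have fit: "k + p div 2 < n"
    if "r \<le> k" "k < n + r" and l: "r \<le> l" "l < n + r" "k \<noteq> l"
      and win: "\<And>j. j + 6 \<le> p div 2 \<Longrightarrow> window g (k + j) = window g (l + j)" for k l
  proof (rule ccontr)
    assume long: "\<not> k + p div 2 < n"
    have k: "k + 7 \<le> n" using window_g_eqD[of k l] win[of 0] that p by simp
    \<comment> \<open>An occurrence reaching \<open>n\<close> would contain the window at
      \<open>n - 6\<close>, which ends on the first letter of the insertion and cannot
      recur.\<close>
    define j where "j = n - 6 - k"
    have j: "j + 6 \<le> p div 2" and kj: "k + j = n - 6" using k long by (auto simp: j_def)
    define l' where "l' = (if l + j < n + r then l + j else l + j - n)"
    have "j < n" using m by (simp add: j_def)
    then have l': "r \<le> l'" "l' < n + r" using l by (auto simp: l'_def)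
    have "k + j \<noteq> l'" using l \<open>k \<noteq> l\<close> \<open>k < n + r\<close> \<open>r \<le> k\<close> by (auto simp: l'_def)
    moreover have "window g (l + j) = window g l'"
      by (intro window_eqI g_add_period) (auto simp: l'_def)
    then have "window g (k + j) = window g l'" using win[OF j] by simp
    moreover have "k + j < n + r" using kj m by linarith
    ultimately have "k + j + 7 \<le> n" using window_g_eqD[of "k + j" l'] l' \<open>r \<le> k\<close> by simp
    then show False using kj k by simp
  qed
  have fit_i: "i + p div 2 < n" using fit[OF i i' win] by simp
  have fit_i': "i' + p div 2 < n" using fit[OF i'(1,2) i i'(3)[symmetric] win[symmetric]] by simp
  have cong: "(i - r + 24) mod 9 = (i' - r + 24) mod 9"
    using window_g_eqD[OF _ i'(3) i i'(1,2)] win[of 0] p by simp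
  have morph_eq: "morph f (i - r + 24 + j) = morph f (i' - r + 24 + j)" if "j \<le> p div 2" for j
  proof -
    have "g (i + j) = g (i' + j)" using rep that g' by (simp add: repeats_def)
    then show ?thesis
      using g_eq_morph[of "i + j"] g_eq_morph[of "i' + j"] that fit_i fit_i' i i' by (simp add: add_ac)
  qed
  \<comment> \<open>If the insertion lies between the two occurrences, deleting it shortens the period by \<open>r\<close>.\<close>
  define P where "P = (if i + p < n + r then p else p - r)"
  have P: "0 < P" "P \<le> p" "P + p div 2 < 9 * m"
    and shift: "i - r + 24 + P = i' - r + 24 + (if i + p < n + r then 0 else 9 * m)"
    using fit_i fit_i' i i' p by (auto simp: P_def i'_def)
  have "(i - r + 24 + P) mod 9 = (i - r + 24 + 0) mod 9"
    unfolding shift using cong by (simp add: mod_add_eq mod_mult_self2 mult.commute)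
  then have "9 dvd P" using mod_eq_dvd_iff_nat[of "i - r + 24" "i - r + 24 + P" 9] by simp
  then obtain p' where p': "P = 9 * p'" by (rule dvdE)
  have "morph f (i - r + 24 + j) = morph f (i - r + 24 + 9 * p' + j)" if "j < Suc (p div 2)" for j
  proof -
    have "morph f (i' - r + 24 + j) = morph f (i' - r + 24 + (if i + p < n + r then 0 else 9 * m) + j)"
      using morph_periodic[of "i' - r + 24 + j"] by (simp add: add_ac)
    then show ?thesis using morph_eq[of j] that by (simp only: p'[symmetric] shift less_Suc_eq_le)
  qed
  \<comment> \<open>The overlap keeps its length when the insertion is deleted, so it still exceeds
    half of the possibly shorter period \<open>9 * p'\<close>.\<close>
  moreover have "p < 2 * Suc (p div 2)" by simp
  then have "9 * p' < 2 * Suc (p div 2)" using P(2) p' by linarith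
  ultimately have "repeats f p' ((i - r + 24) div 9)" by (rule morph_repeats_imp_repeats)
  moreover have "0 < p'" "p' + p' div 2 < m" using P p' by linarith+
  ultimately show False using f by (simp add: circ_free_def)
qed

lemma circ_free_g: "circ_free n g"
  unfolding circ_free_def
proof (intro conjI allI impI)
  fix p i :: nat assume p: "0 < p" "p + p div 2 < n"
  \<comment> \<open>Each residue modulo \<open>n\<close> has one representative in the range treated
    above.\<close>
  define k where "k = (if i mod n < r then i mod n + n else i mod n)"
  have "i mod n < n" using m by simp
  then have k: "r \<le> k" "k < n + r" by (auto simp: k_def)
  have "k mod n = i mod n" by (simp add: k_def)
  then have "g (k + j) = g (i + j)" for j by (intro g_cong_mod mod_add_cong) simp_all
  then have "repeats g p k = repeats g p i" by (simp add: repeats_def add.assoc)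
  moreover have "\<not> repeats g p k"
  proof (cases "p \<le> 11")
    case False
    then have "12 \<le> p" by simp
    then show ?thesis by (rule g_no_long_repeats[OF _ p(2) k])
  qed (rule g_no_short_repeats[OF p(1) _ k])
  ultimately show "\<not> repeats g p i" by simp
qed (rule g_periodic)

text \<open>The seed recurs at position 12 of its own image, in front of the insertion.\<close>

lemma g_seed: "i < 5 \<Longrightarrow> g (i + (n - 12)) = seed ! i"
proof -
  assume i: "i < 5"
  have "g (i + (n - 12)) = extended_seed M ! (12 + i)"
    using i m g_eq_extended_seed[of "i + (n - 12)"] by simp
  also have "\<dots> = seed_image ! (12 + i)"
    using i by (simp add: extended_seed_def nth_append length_seed_image)
  also have "\<dots> = take 5 (drop 12 seed_image) ! i"
    using i by (simp add: length_seed_image)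
  also have "take 5 (drop 12 seed_image) = seed"
    by code_simp
  finally show ?thesis .
qed

end

section \<open>Induction on the length\<close>

lemma ex_circ_free_seed:
  "5 \<le> n \<Longrightarrow> \<exists>f. circ_free n f \<and> (\<forall>i<5. f i = seed ! i)"
proof (induction n rule: less_induct)
  case (less n)
  show ?case
  proof (cases "n < 46")
    case False
    \<comment> \<open>Dividing \<open>n - 1\<close> instead of \<open>n\<close> makes the insertion
      length run from 1 to 9; \<open>n \<ge> 46\<close> gives \<open>m \<ge> 5\<close>.\<close>
    define m where "m = (n - 1) div 9"
    define r where "r = (n - 1) mod 9 + 1"
    have "n - 1 = 9 * m + (n - 1) mod 9" by (simp add: m_def)
    then have n: "n = 9 * m + r" using False by (simp add: r_def)
    have r: "1 \<le> r" "r \<le> 9" by (auto simp: r_def less_eq_Suc_le[symmetric])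
    have m: "5 \<le> m" "m < n" using n r False by auto
    obtain f where f: "circ_free m f" "\<forall>i<5. f i = seed ! i" using less.IH[OF m(2,1)] by blast
    obtain M where M: "M \<in> set insertions" "length M = r" using ex_insertion[OF r] by blast
    have nM: "n = 9 * m + length M" using n M by simp
    interpret lengthening f m M
      using f m M by unfold_locales auto
    \<comment> \<open>The rotation moves the recurring seed to the front, as the induction
      requires.\<close>
    have "circ_free n (\<lambda>i. g (i + (n - 12)))"
      unfolding nM by (rule circ_free_shift[OF circ_free_g])
    moreover have "\<forall>i<5. g (i + (n - 12)) = seed ! i" unfolding nM using g_seed by blast
    ultimately show ?thesis by blast
  qed (use less.prems ex_base_word in blast)
qed

lemma ex_circ_free: "\<exists>f :: nat \<Rightarrow> letter. circ_free n f"
proof (cases "5 \<le> n")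
  case False
  \<comment> \<open>Lengths 1 to 4 are too short for the seed; pairwise distinct letters serve
    instead.\<close>
  have "\<forall>k\<in>set [1..<5]. free_upto ((2 * length (take k letters) - 1) div 3) (take k letters @ take k letters)"
    by code_simp
  then have free: "free_upto ((2 * length (take n letters) - 1) div 3) (take n letters @ take n letters)"
    if "n \<noteq> 0" using that False by simp
  show ?thesis
  proof (cases "n = 0")
    case True
    then show ?thesis by (auto simp: circ_free_def)
  next
    case n: False
    then have "take n letters \<noteq> []" "length (take n letters) = n" using False by (auto simp: letters_def)
    then show ?thesis using circ_free_nth_mod[OF free[OF n]] by auto
  qed
qed (use ex_circ_free_seed in blast)

theorem theorem2p7:
  fixes A :: "'a set"
  assumes "card A = 4"
  shows "\<forall>n::nat. \<exists>w. length w = n \<and> set w \<subseteq> A \<and> circular_plus_free (3/2) (circular_word w)"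
proof
  fix n :: nat
  \<comment> \<open>\<open>card\<close> is 0 on infinite sets.\<close>
  have fin: "finite A" using assms by (metis card.infinite zero_neq_numeral)
  have "card (UNIV :: letter set) = card A"
    unfolding set_letters[symmetric] by (simp add: letters_def assms)
  moreover have "finite (UNIV :: letter set)" by (metis set_letters List.finite_set)
  ultimately obtain e :: "letter \<Rightarrow> 'a" where e: "bij_betw e UNIV A"
    using fin finite_same_card_bij by metis
  obtain f :: "nat \<Rightarrow> letter" where f: "circ_free n f" using ex_circ_free by blast
  let ?w = "map (\<lambda>i. e (f i)) [0..<n]"
  have "inj e" using e by (simp add: bij_betw_def)
  then have "circular_plus_free (3/2) (circular_word ?w)"
    by (rule circ_free_imp_circular_plus_free[OF f])
  moreover have "set ?w \<subseteq> A" using e by (auto simp: bij_betw_def)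
  ultimately show "\<exists>w. length w = n \<and> set w \<subseteq> A \<and> circular_plus_free (3/2) (circular_word w)"
    by (intro exI[of _ ?w]) simp
qed

end
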